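(* Using Mechanism $GM^*$, for any finite set $\mathcal{F}$ of possible facility locations (in an arbitrary metric space, with $n$ clients of which $k$ are strategic), the price of stability is at most $\frac{n+1}{n-1}$ when $k=1$ and is at most $\frac{n+\frac{k}{k-1}}{n-\frac{k}{k-1}}$ when $k>1$. Thus, for arbitrary $k$, the price of stability is at most $\frac{n+2}{n-2}$.
   Context: Setting. An instance consists of a metric space with distance $d$; a set $\mathcal{C}$ of $n$ clients, each having a true location in the metric space (several clients may share a location; the true location of client $i$ is also denoted $i$); a finite set $\mathcal{F}$ of possible facility locations in the metric space, with a fixed ordering (a location earlier in the ordering is called lower-numbered); and a partition $\mathcal{C}=T\cup L$, $T\cap L=\emptyset$, with $|L|=k$, $|T|=n-k$. Clients in $T$ always report their true location; each client $i\in L$ (strategic) may report any point $x_i$ of the metric space. Let $\vec t$ be the vector of true locations of clients in $T$ and $\vec x=(x_i)_{i\in L}$ the vector of reports of the strategic clients. Perceived cost of $A\in\mathcal{F}$: $cost_A(\vec t;\vec x)=\sum_{i\in T}d(i,A)+\sum_{i\in L}d(x_i,A)$. Mechanism $GM^*$: given reports $(\vec t;\vec x)$, output the facility $GM^*(\vec t;\vec x)\in\mathcal{F}$ minimizing $cost_A(\vec t;\vec x)$ over $A\in\mathcal{F}$, ties broken in favor of the lowest-numbered facility. Nash equilibrium (NE) under a mechanism $M$: a profile $(\vec t;\vec x)$ such that for every $i\in L$ and every location $x_i'$ that $i$ can report, $d(i,M(\vec t;\vec x_{-i},x_i'))\ge d(i,M(\vec t;\vec x))$, where $(\vec x_{-i},x_i')$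 is $\vec x$ with $i$'s report replaced by $x_i'$. Price of stability: let $O\in\mathcal{F}$ be the optimal solution, i.e. a facility location minimizing the true cost $\sum_{i\in\mathcal{C}}d(i,O)$, and let $S$ be the set of facilities $A$ such that some NE under the mechanism selects $A$. The price of stability of an instance is $\inf_{A\in S}\frac{\sum_{i\in\mathcal{C}}d(i,A)}{\sum_{i\in\mathcal{C}}d(i,O)}$; the price of stability of a mechanism is the worst case of this quantity over all instances. *)

theory Defs
  imports "HOL-Analysis.Analysis"
begin

text \<open>
  Clients are indices of type \<open>'c\<close>, so that several of them may share a location.
  The ordering of the finite set of facilities is given by an injective numbering.
\<close>

record ('c, 'a) instance_data =
  points     :: "'a set"
  distance   :: "'a \<Rightarrow> 'a \<Rightarrow> real"
  clients    :: "'c set"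
  strategic  :: "'c set"
  location   :: "'c \<Rightarrow> 'a"
  facilities :: "'a set"
  numbering  :: "'a \<Rightarrow> nat"

definition facility_instance :: "('c, 'a) instance_data \<Rightarrow> bool" where
  "facility_instance I \<longleftrightarrow>
     Metric_space (points I) (distance I) \<and>
     finite (clients I) \<and> strategic I \<subseteq> clients I \<and>
     location I \<in> clients I \<rightarrow> points I \<and>
     finite (facilities I) \<and> facilities I \<noteq> {} \<and> facilities I \<subseteq> points I \<and>
     inj_on (numbering I) (facilities I)"

definition truthful :: "('c, 'a) instance_data \<Rightarrow> 'c set" where
  "truthful I = clients I - strategic I"

definition true_cost :: "('c, 'a) instance_data \<Rightarrow> 'a \<Rightarrow> real" where
  "true_cost I A = (\<Sum>i\<in>clients I. distance I (location I i) A)"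

definition perceived_cost ::
    "('c, 'a) instance_data \<Rightarrow> ('c \<Rightarrow> 'a) \<Rightarrow> ('c \<Rightarrow> 'a) \<Rightarrow> 'a \<Rightarrow> real" where
  "perceived_cost I t x A =
     (\<Sum>i\<in>truthful I. distance I (t i) A) + (\<Sum>i\<in>strategic I. distance I (x i) A)"

text \<open>
  For a fixed instance, a mechanism maps the reports \<open>t\<close> of the truthful clients and
  \<open>x\<close> of the strategic clients to a facility. The mechanism below returns the
  lowest-numbered minimizer of the perceived cost.
\<close>

type_synonym ('c, 'a) mechanism = "('c \<Rightarrow> 'a) \<Rightarrow> ('c \<Rightarrow> 'a) \<Rightarrow> 'a"

definition GM_star :: "('c, 'a) instance_data \<Rightarrow> ('c, 'a) mechanism" where
  "GM_star I t x =
     arg_min (numbering I) (is_arg_min (perceived_cost I t x) (\<lambda>A. A \<in> facilities I))"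

text \<open>
  The restriction hides the true locations of the strategic clients from the mechanism.
\<close>

definition truthful_reports :: "('c, 'a) instance_data \<Rightarrow> 'c \<Rightarrow> 'a" where
  "truthful_reports I = restrict (location I) (truthful I)"

definition nash_equilibrium ::
    "('c, 'a) instance_data \<Rightarrow> ('c, 'a) mechanism \<Rightarrow> ('c \<Rightarrow> 'a) \<Rightarrow> bool" where
  "nash_equilibrium I M x \<longleftrightarrow>
     x \<in> strategic I \<rightarrow>\<^sub>E points I \<and>
     (\<forall>i\<in>strategic I. \<forall>y\<in>points I.
        distance I (location I i) (M (truthful_reports I) (x(i := y)))
          \<ge> distance I (location I i) (M (truthful_reports I) x))"

definition equilibrium_facilities ::
    "('c, 'a) instance_data \<Rightarrow> ('c, 'a) mechanism \<Rightarrow> 'a set" where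
  "equilibrium_facilities I M =
     {A \<in> facilities I. \<exists>x. nash_equilibrium I M x \<and> M (truthful_reports I) x = A}"

definition optimal_facility :: "('c, 'a) instance_data \<Rightarrow> 'a" where
  "optimal_facility I = arg_min_on (true_cost I) (facilities I)"

text \<open>
  The ratio of two nonnegative costs. A positive cost over a zero optimum gives \<open>\<infinity>\<close>, as
  \<open>a / 0 = \<infinity>\<close> for \<open>a > 0\<close> in \<^typ>\<open>ereal\<close>; the case \<open>0 / 0\<close> is set to \<open>1\<close>, since the
  facility is then itself optimal.
\<close>

definition cost_ratio :: "real \<Rightarrow> real \<Rightarrow> ereal" where
  "cost_ratio a b = (if a = 0 \<and> b = 0 then 1 else ereal a / ereal b)"

text \<open>If there is no equilibrium, the infimum over the empty set is \<open>\<infinity>\<close>.\<close>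

definition price_of_stability ::
    "('c, 'a) instance_data \<Rightarrow> ('c, 'a) mechanism \<Rightarrow> ereal" where
  "price_of_stability I M =
     (INF A\<in>equilibrium_facilities I M.
        cost_ratio (true_cost I A) (true_cost I (optimal_facility I)))"

end

theory Submission
  imports Defs
begin

text \<open>
  If a facility \<open>A\<close> satisfies \<open>cost A \<le> cost O + r * d O A\<close> for an optimal \<open>O\<close>, then summing
  \<open>d O A \<le> d i O + d i A\<close> over all clients gives \<open>(n - r) * cost A \<le> (n + r) * cost O\<close>.
  It remains to find an equilibrium with \<open>r = 1\<close> for \<open>k = 1\<close> and \<open>r = k / (k - 1)\<close> for \<open>k > 1\<close>.

  For \<open>k = 1\<close>, a best response of the strategic client is an equilibrium, and it is at least as
  good for that client as truth-telling.

  For \<open>k > 1\<close>, start with all strategic clients reporting \<open>O\<close> and repeatedly move all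
  reports to a facility \<open>B\<close> that wins against the common report \<open>A\<close> when one client
  profitably deviates. Such a step costs the other strategic clients at most \<open>(k - 1) * d A B\<close> in
  total, and lowers the cost of the truthful clients by at least \<open>(k - 2) * d A B\<close>. The process
  stops at an equilibrium \<open>A\<close>. If the path from \<open>O\<close> to \<open>A\<close> has length \<open>D\<close>, the change of
  the true cost is at most \<open>D\<close>, and also at most \<open>k * d O A - (k - 2) * D\<close>. Eliminating \<open>D\<close>
  gives the factor \<open>k / (k - 1)\<close>.
\<close>

lemma fun_upd_restrict_singleton:
  assumes "L = {i}"
  shows "(\<lambda>j\<in>L. y)(i := z) = (\<lambda>j\<in>L. z)"
  using assms by (auto simp: fun_eq_iff)

section \<open>Costs and the outcome of the mechanism\<close>

locale facility_game =
  fixes I :: "('c, 'a) instance_data"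
  assumes facility_instance: "facility_instance I"
begin

abbreviation "d \<equiv> distance I"
abbreviation "C \<equiv> clients I"
abbreviation "L \<equiv> strategic I"
abbreviation "T \<equiv> truthful I"
abbreviation "loc \<equiv> location I"
abbreviation "F \<equiv> facilities I"

definition truthful_cost :: "'a \<Rightarrow> real" where
  "truthful_cost A = (\<Sum>i\<in>T. d (loc i) A)"

definition strategic_cost :: "'a \<Rightarrow> real" where
  "strategic_cost A = (\<Sum>i\<in>L. d (loc i) A)"

definition outcome :: "('c \<Rightarrow> 'a) \<Rightarrow> 'a" where
  "outcome = GM_star I (truthful_reports I)"

sublocale Metric_space "points I" d
  using facility_instance by (simp add: facility_instance_def)

lemma finite_clients [simp]: "finite C" and finite_strategic [simp]: "finite L"
  and finite_facilities [simp]: "finite F" and facilities_nonempty: "F \<noteq> {}"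
  and strategic_subset: "L \<subseteq> C"
  using facility_instance by (auto simp: facility_instance_def intro: finite_subset)

lemma location_in_points [simp]: "i \<in> C \<Longrightarrow> loc i \<in> points I"
  using facility_instance by (auto simp: facility_instance_def)

lemma strategic_in_clients [simp]: "i \<in> L \<Longrightarrow> i \<in> C"
  using strategic_subset by blast

lemma facility_in_points [simp]: "A \<in> F \<Longrightarrow> A \<in> points I"
  using facility_instance by (auto simp: facility_instance_def)

lemma numbering_inj: "A \<in> F \<Longrightarrow> B \<in> F \<Longrightarrow> numbering I A = numbering I B \<Longrightarrow> A = B"
  using facility_instance by (auto simp: facility_instance_def dest: inj_onD)

lemma true_cost_split: "true_cost I A = truthful_cost A + strategic_cost A"
  unfolding true_cost_def truthful_cost_def strategic_cost_def truthful_def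
  by (simp add: sum.subset_diff[OF strategic_subset])

lemma perceived_cost_truthful_reports:
  "perceived_cost I (truthful_reports I) x A = truthful_cost A + (\<Sum>i\<in>L. d (x i) A)"
  by (simp add: perceived_cost_def truthful_reports_def truthful_cost_def)

lemma optimal_facility: "optimal_facility I \<in> F"
  and true_cost_optimal_le: "A \<in> F \<Longrightarrow> true_cost I (optimal_facility I) \<le> true_cost I A"
  using arg_min_if_finite[OF finite_facilities facilities_nonempty, of "true_cost I"]
  unfolding optimal_facility_def by force+

text \<open>Later arguments use the mechanism only through these facts; the strict inequality
  records the tie-breaking.\<close>

lemma outcome_properties:
  shows outcome_in_facilities [simp]: "outcome x \<in> F"
    and outcome_le: "B \<in> F \<Longrightarrow> truthful_cost (outcome x) + (\<Sum>i\<in>L. d (x i) (outcome x))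
                        \<le> truthful_cost B + (\<Sum>i\<in>L. d (x i) B)"
    and outcome_less: "B \<in> F \<Longrightarrow> numbering I B < numbering I (outcome x) \<Longrightarrow>
                        truthful_cost (outcome x) + (\<Sum>i\<in>L. d (x i) (outcome x))
                        < truthful_cost B + (\<Sum>i\<in>L. d (x i) B)"
proof -
  let ?p = "perceived_cost I (truthful_reports I) x"
  let ?P = "is_arg_min ?p (\<lambda>A. A \<in> F)"
  have "?P (arg_min_on ?p F)"
    using arg_min_if_finite[OF finite_facilities facilities_nonempty, of ?p]
    by (auto simp: is_arg_min_def)
  from arg_min_nat_lemma[of ?P, OF this, of "numbering I"]
  have *: "?P (outcome x)" "\<And>y. ?P y \<Longrightarrow> numbering I (outcome x) \<le> numbering I y"
    unfolding outcome_def GM_star_def by auto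
  show "outcome x \<in> F"
    using *(1) by (simp add: is_arg_min_linorder)
  have le: "?p (outcome x) \<le> ?p B" if "B \<in> F" for B
    using *(1) that by (simp add: is_arg_min_linorder)
  show "truthful_cost (outcome x) + (\<Sum>i\<in>L. d (x i) (outcome x))
          \<le> truthful_cost B + (\<Sum>i\<in>L. d (x i) B)" if "B \<in> F"
    using le[OF that] by (simp add: perceived_cost_truthful_reports)
  show "truthful_cost (outcome x) + (\<Sum>i\<in>L. d (x i) (outcome x))
          < truthful_cost B + (\<Sum>i\<in>L. d (x i) B)"
    if B: "B \<in> F" "numbering I B < numbering I (outcome x)"
  proof -
    have "\<not> ?P B"
      using *(2)[of B] B by auto
    then have "\<not> ?p B \<le> ?p (outcome x)"
      using B le by (auto simp: is_arg_min_linorder intro: order_trans)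
    then show ?thesis
      by (simp add: perceived_cost_truthful_reports)
  qed
qed

lemma equilibrium_facilityI:
  assumes "x \<in> L \<rightarrow>\<^sub>E points I"
    and "\<And>i y. i \<in> L \<Longrightarrow> y \<in> points I \<Longrightarrow> d (loc i) (outcome x) \<le> d (loc i) (outcome (x(i := y)))"
  shows "outcome x \<in> equilibrium_facilities I (GM_star I)"
  using assms outcome_in_facilities[of x]
  unfolding equilibrium_facilities_def nash_equilibrium_def outcome_def by blast

section \<open>From a cost bound to the price of stability\<close>

lemma card_mult_dist_le:
  assumes "A \<in> F" "B \<in> F"
  shows "real (card C) * d B A \<le> true_cost I A + true_cost I B"
proof -
  have "real (card C) * d B A = (\<Sum>i\<in>C. d B A)" by simp
  also have "\<dots> \<le> (\<Sum>i\<in>C. d (loc i) A + d (loc i) B)"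
    using assms by (intro sum_mono) (metis add.commute commute facility_in_points location_in_points triangle)
  finally show ?thesis
    by (simp add: true_cost_def sum.distrib)
qed

text \<open>\<open>B\<close> may be any facility of optimal cost: for one strategic client it will
  be the truth-telling outcome, which can differ from \<open>optimal_facility I\<close>.\<close>

lemma price_of_stability_le:
  assumes A: "A \<in> equilibrium_facilities I (GM_star I)"
    and B: "B \<in> F" "true_cost I B \<le> true_cost I (optimal_facility I)"
    and cost: "true_cost I A \<le> true_cost I B + r * d B A"
    and r: "0 \<le> r" "r \<le> real n" "0 < n" and n: "card C = n"
  shows "price_of_stability I (GM_star I) \<le> ereal (real n + r) / ereal (real n - r)"
proof (cases "r = real n")
  case True
  \<comment> \<open>The bound is a positive number over zero, which is infinite in
    \<open>ereal\<close>.\<close>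
  then show ?thesis using r by (simp add: divide_ereal_def zero_ereal_def[symmetric])
next
  case False
  with r have pos: "real n - r > 0" by simp
  let ?O = "optimal_facility I"
  let ?a = "true_cost I A" and ?o = "true_cost I ?O"
  have AF: "A \<in> F" using A by (simp add: equilibrium_facilities_def)
  have nonneg: "0 \<le> ?a" "0 \<le> ?o" by (simp_all add: true_cost_def sum_nonneg)
  have "true_cost I B = ?o"
    using B true_cost_optimal_le[of B] by simp
  then have "?a \<le> ?o + r * d B A" and dist: "real n * d B A \<le> ?a + ?o"
    using cost card_mult_dist_le[OF AF B(1)] n by auto
  then have "real n * ?a \<le> real n * ?o + r * (real n * d B A)"
    using mult_left_mono[of ?a "?o + r * d B A" "real n"] by (simp add: algebra_simps)
  also have "\<dots> \<le> real n * ?o + r * (?a + ?o)"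
    using dist r by (intro add_left_mono mult_left_mono)
  finally have main: "(real n - r) * ?a \<le> (real n + r) * ?o"
    by (simp add: algebra_simps)
  have "cost_ratio ?a ?o \<le> ereal (real n + r) / ereal (real n - r)"
  \<comment> \<open>If the optimum is zero, \<open>main\<close> forces \<open>?a = 0\<close>, and
    the convention for \<open>0 / 0\<close> applies.\<close>
  proof (cases "?o = 0")
    case True
    then have "?a = 0"
      using main pos nonneg by (simp add: mult_le_0_iff)
    then show ?thesis
      using True pos r by (simp add: cost_ratio_def one_ereal_def)
  next
    case False
    with nonneg have "?o > 0" by simp
    then show ?thesis
      using main pos by (simp add: cost_ratio_def divide_simps mult.commute)
  qed
  then show ?thesis
    unfolding price_of_stability_def using A by (rule INF_lower2[rotated])
qed

section \<open>At most one strategic client\<close>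

lemma truthful_outcome_optimal:
  "true_cost I (outcome (restrict loc L)) \<le> true_cost I (optimal_facility I)"
  \<comment> \<open>Under truthful reports the perceived cost is the true cost.\<close>
  using outcome_le[OF optimal_facility, of "restrict loc L"]
  by (simp add: true_cost_split strategic_cost_def)

lemma truthful_outcome_equilibrium_if_no_strategic:
  assumes "L = {}"
  shows "outcome (restrict loc L) \<in> equilibrium_facilities I (GM_star I)"
  using assms by (intro equilibrium_facilityI) auto

text \<open>\<open>B\<close> is the truth-telling outcome and \<open>A\<close> the best outcome that
  the strategic client can force, by a report \<open>y\<close>. Since \<open>A\<close> wins at
  \<open>y\<close>, the triangle inequality limits the loss of the truthful clients to
  \<open>d B A\<close>.\<close>

lemma good_equilibrium_one_strategic:
  assumes "card L = 1"
  obtains A B where "A \<in> equilibrium_facilities I (GM_star I)" "B \<in> F"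
    "true_cost I B \<le> true_cost I (optimal_facility I)"
    "true_cost I A \<le> true_cost I B + d B A"
proof -
  obtain i where L: "L = {i}"
    using assms by (auto simp: card_1_singleton_iff)
  then have i: "i \<in> C" using strategic_subset by auto
  let ?out = "\<lambda>y. outcome (\<lambda>j\<in>L. y)"
  let ?R = "?out ` points I"
  \<comment> \<open>There may be infinitely many reports, but only finitely many outcomes, so a best
    one exists.\<close>
  have fin: "finite ?R"
    by (rule finite_subset[OF _ finite_facilities]) auto
  have ne: "?R \<noteq> {}"
    using location_in_points[OF i] by blast
  obtain A where A: "A \<in> ?R" "\<And>B. B \<in> ?R \<Longrightarrow> d (loc i) A \<le> d (loc i) B"
    using arg_min_if_finite[OF fin ne, of "d (loc i)"] by (metis not_le)
  then obtain y where y: "y \<in> points I" "A = ?out y" by blast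
  define B where "B = outcome (restrict loc L)"
  have B: "B = ?out (loc i)" unfolding B_def using L by (simp add: restrict_def fun_eq_iff cong: if_cong)
  have AF: "A \<in> F" and BF: "B \<in> F" using y B by auto
  have "A \<in> equilibrium_facilities I (GM_star I)"
    unfolding y(2) using y A(2) L
    by (intro equilibrium_facilityI) (auto simp: fun_upd_restrict_singleton)
  moreover have "true_cost I A \<le> true_cost I B + d B A"
  proof -
    have "truthful_cost A + d y A \<le> truthful_cost B + d y B"
      using outcome_le[OF BF, of "\<lambda>j\<in>L. y"] y(2) L by simp
    moreover have "d y B \<le> d y A + d B A"
      using triangle[of y A B] y(1) AF BF by (simp add: commute)
    moreover have "d (loc i) A \<le> d (loc i) B"
      using A(2)[of B] B i by auto
    ultimately show ?thesis
      by (simp add: true_cost_split strategic_cost_def L)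
  qed
  ultimately show thesis
    using that BF truthful_outcome_optimal unfolding B_def by blast
qed

section \<open>At least two strategic clients\<close>

text \<open>
  \<open>reachable Q A\<close> records the two estimates that hold along a path of length \<open>D\<close> from \<open>Q\<close> to \<open>A\<close>.
\<close>

definition reachable :: "'a \<Rightarrow> 'a \<Rightarrow> bool" where
  "reachable Q A \<longleftrightarrow> A \<in> F \<and> (\<exists>D\<ge>0.
     truthful_cost A + (real (card L) - 2) * D \<le> truthful_cost Q \<and>
     strategic_cost A \<le> strategic_cost Q + (real (card L) - 1) * D)"

lemma reachable_refl: "Q \<in> F \<Longrightarrow> reachable Q Q"
  unfolding reachable_def by (auto intro!: exI[of _ 0])

lemma reachable_step:
  assumes "reachable Q A" "B \<in> F" "0 \<le> e"
    and "truthful_cost B + (real (card L) - 2) * e \<le> truthful_cost A"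
    and "strategic_cost B \<le> strategic_cost A + (real (card L) - 1) * e"
  shows "reachable Q B"
proof -
  obtain D where "0 \<le> D" "truthful_cost A + (real (card L) - 2) * D \<le> truthful_cost Q"
     "strategic_cost A \<le> strategic_cost Q + (real (card L) - 1) * D"
    using assms(1) by (auto simp: reachable_def)
  then show ?thesis
    unfolding reachable_def using assms(2-)
    by (intro conjI exI[of _ "D + e"]) (auto simp: distrib_left)
qed

lemma strategic_cost_le:
  assumes "M \<subseteq> L" "A \<in> F" "B \<in> F"
  shows "(\<Sum>i\<in>M. d (loc i) B) \<le> (\<Sum>i\<in>M. d (loc i) A) + real (card M) * d A B"
proof -
  have "(\<Sum>i\<in>M. d (loc i) B) \<le> (\<Sum>i\<in>M. d (loc i) A + d A B)"
    using assms by (intro sum_mono triangle) auto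
  then show ?thesis by (simp add: sum.distrib)
qed

lemma reachable_true_cost_le:
  assumes "reachable Q A" "Q \<in> F" and k: "card L = k" "1 < k"
  shows "true_cost I A \<le> true_cost I Q + real k / (real k - 1) * d Q A"
proof -
  define c where "c = true_cost I A - true_cost I Q"
  obtain D where D: "truthful_cost A + (real k - 2) * D \<le> truthful_cost Q"
     "strategic_cost A \<le> strategic_cost Q + (real k - 1) * D"
    using assms(1) k by (auto simp: reachable_def)
  have A: "A \<in> F" using assms(1) by (simp add: reachable_def)
  have 1: "c \<le> D"
    using D by (simp add: c_def true_cost_split algebra_simps)
  have 2: "c \<le> real k * d Q A - (real k - 2) * D"
    using D(1) strategic_cost_le[OF subset_refl \<open>Q \<in> F\<close> A] k
    by (simp add: c_def true_cost_split strategic_cost_def)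
  \<comment> \<open>Scaled by \<open>k - 2\<close>, the first bound cancels \<open>D\<close> in the
    second.\<close>
  have "(real k - 2) * c \<le> (real k - 2) * D"
    using 1 k by (intro mult_left_mono) auto
  with 2 have "(real k - 1) * c \<le> real k * d Q A"
    by (simp add: algebra_simps)
  then show ?thesis
    using k by (simp add: c_def field_simps)
qed

lemma sum_report_deviation:
  assumes "i \<in> L"
  shows "(\<Sum>j\<in>L. d (((\<lambda>j\<in>L. A)(i := y)) j) B) = (real (card L) - 1) * d A B + d y B"
proof -
  \<comment> \<open>Makes the truncated difference \<open>card L - 1\<close> agree with the real
    one.\<close>
  have "real (card L) \<ge> 1"
    using assms by (simp add: Suc_le_eq card_gt_0_iff) (use assms in blast)
  then show ?thesis
    using assms by (simp add: sum.remove)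
qed

text \<open>Instead of running the process, choose its end point: among the reachable facilities of
  least truthful cost, the lowest-numbered one. Any further step contradicts this choice.\<close>

lemma good_equilibrium_many_strategic:
  assumes k: "card L = k" "1 < k" and "Q \<in> F"
  obtains A where "A \<in> equilibrium_facilities I (GM_star I)"
    "true_cost I A \<le> true_cost I Q + real k / (real k - 1) * d Q A"
proof -
  let ?S = "{A. reachable Q A}"
  let ?x = "\<lambda>A. (\<lambda>j\<in>L. A)"
  have "finite ?S"
    by (rule finite_subset[OF _ finite_facilities]) (auto simp: reachable_def)
  moreover have "?S \<noteq> {}" using reachable_refl[OF \<open>Q \<in> F\<close>] by auto
  ultimately have arg: "is_arg_min truthful_cost (reachable Q) (arg_min_on truthful_cost ?S)"
    using arg_min_if_finite[of ?S truthful_cost] by (auto simp: is_arg_min_def)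
  define A where "A = arg_min (numbering I) (is_arg_min truthful_cost (reachable Q))"
  have "is_arg_min truthful_cost (reachable Q) A"
    and num: "\<And>B. is_arg_min truthful_cost (reachable Q) B \<Longrightarrow> numbering I A \<le> numbering I B"
    using arg_min_nat_lemma[of "is_arg_min truthful_cost (reachable Q)", OF arg, of "numbering I"]
    unfolding A_def by auto
  then have A: "reachable Q A" and min: "\<And>B. reachable Q B \<Longrightarrow> truthful_cost A \<le> truthful_cost B"
    by (auto simp: is_arg_min_linorder)
  have AF: "A \<in> F" using A by (simp add: reachable_def)
  have unanimous: "outcome (?x A) = A"
  proof (rule ccontr)
    define B where "B = outcome (?x A)"
    \<comment> \<open>Chosen so that \<open>(k - 1) * e\<close> pays for all \<open>k\<close>
      strategic clients moving from \<open>A\<close> to \<open>B\<close>, while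
      \<open>(k - 2) * e\<close> stays within the drop \<open>k * d A B\<close> of the truthful
      cost.\<close>
    define e where "e = real k / (real k - 1) * d A B"
    assume "outcome (?x A) \<noteq> A"
    then have neq: "B \<noteq> A" and BF: "B \<in> F" by (auto simp: B_def)
    then have dpos: "d A B > 0" using AF by simp
    have sum: "(\<Sum>i\<in>L. d (?x A i) A') = real k * d A A'" for A' using k by simp
    have le: "truthful_cost B + real k * d A B \<le> truthful_cost A"
      using outcome_le[OF AF, of "?x A"] AF unfolding B_def[symmetric] sum by simp
    have "(real k - 2) * real k \<le> real k * (real k - 1)" using k by (simp add: algebra_simps)
    then have "(real k - 2) * e \<le> real k * d A B"
      using k dpos unfolding e_def by (simp add: field_simps)
    moreover have "(real k - 1) * e = real k * d A B"
      using k by (simp add: e_def)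
    moreover have "0 \<le> e" using k by (simp add: e_def)
    ultimately have "reachable Q B"
      using le k strategic_cost_le[OF subset_refl AF BF]
      by (intro reachable_step[OF A BF, of e]) (auto simp: strategic_cost_def)
    moreover have "real k * d A B > 0" using dpos k by simp
    ultimately show False using min[of B] le by simp
  qed
  have "outcome (?x A) \<in> equilibrium_facilities I (GM_star I)"
  proof (rule equilibrium_facilityI)
    show "?x A \<in> L \<rightarrow>\<^sub>E points I" using AF by auto
    fix i y assume i: "i \<in> L" and y: "y \<in> points I"
    define B where "B = outcome ((?x A)(i := y))"
    have BF: "B \<in> F" by (simp add: B_def)
    have "d (loc i) A \<le> d (loc i) B"
    proof (rule ccontr)
      assume less: "\<not> d (loc i) A \<le> d (loc i) B"
      then have "A \<noteq> B" by auto
      have sum: "(\<Sum>j\<in>L. d (((?x A)(i := y)) j) A') = (real k - 1) * d A A' + d y A'" for A'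
        using sum_report_deviation[OF i] k by simp
      have le: "truthful_cost B + (real k - 1) * d A B + d y B \<le> truthful_cost A + d y A"
        using outcome_le[OF AF, of "(?x A)(i := y)"] AF unfolding B_def[symmetric] sum by simp
      \<comment> \<open>The deviating report can offset at most one of the \<open>k - 1\<close>
        copies of \<open>d A B\<close>.\<close>
      have tri: "d y A \<le> d y B + d A B"
        using triangle[of y B A] y AF BF by (simp add: commute)
      have desc: "truthful_cost B + (real k - 2) * d A B \<le> truthful_cost A"
        using le tri by (simp add: algebra_simps)
      have "strategic_cost B = (\<Sum>j\<in>L - {i}. d (loc j) B) + d (loc i) B"
        using i by (simp add: strategic_cost_def sum.remove)
      \<comment> \<open>The deviator gains, so only the other \<open>k - 1\<close> strategic clients
        can lose.\<close>
      also have "\<dots> \<le> (\<Sum>j\<in>L - {i}. d (loc j) A) + (real k - 1) * d A B + d (loc i) A"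
        using strategic_cost_le[of "L - {i}", OF _ AF BF] less i k by (auto)
      also have "\<dots> = strategic_cost A + (real k - 1) * d A B"
        using i by (simp add: strategic_cost_def sum.remove)
      finally have reach: "reachable Q B"
        using desc k by (intro reachable_step[OF A BF, of "d A B"]) auto
      have "0 \<le> (real k - 2) * d A B" using k by simp
      then have eq: "truthful_cost B \<le> truthful_cost A" using desc by linarith
      \<comment> \<open>For \<open>k = 2\<close> the descent need not be strict, so numbering
        decides: \<open>A\<close> precedes \<open>B\<close>, hence can lose to \<open>B\<close> only
        strictly.\<close>
      have "is_arg_min truthful_cost (reachable Q) B"
        using reach eq min by (auto simp: is_arg_min_linorder intro: order_trans)
      from num[OF this] have "numbering I A < numbering I B"
        using \<open>A \<noteq> B\<close> numbering_inj[OF AF BF] by fastforce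
      then have "truthful_cost B + (real k - 1) * d A B + d y B < truthful_cost A + d y A"
        using outcome_less[OF AF, of "(?x A)(i := y)"] AF unfolding B_def[symmetric] sum by simp
      then have "truthful_cost B + (real k - 2) * d A B < truthful_cost A"
        using tri by (simp add: algebra_simps)
      then show False
        using \<open>0 \<le> (real k - 2) * d A B\<close> min[OF reach] by linarith
    qed
    then show "d (loc i) (outcome (?x A)) \<le> d (loc i) (outcome ((?x A)(i := y)))"
      by (simp add: unanimous B_def)
  qed
  then show thesis
    using that reachable_true_cost_le[OF A \<open>Q \<in> F\<close> k] unanimous by simp
qed

end

theorem theorem3p3:
  fixes I :: "('c, 'a) instance_data" and n k :: nat
  assumes "facility_instance I"
    and "card (clients I) = n"
    and "card (strategic I) = k"
  shows "(k = 1 \<longrightarrow>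
            price_of_stability I (GM_star I) \<le> ereal (real n + 1) / ereal (real n - 1)) \<and>
         (k > 1 \<longrightarrow>
            price_of_stability I (GM_star I)
              \<le> ereal (real n + real k / (real k - 1)) / ereal (real n - real k / (real k - 1))) \<and>
         (n \<ge> 2 \<longrightarrow>
            price_of_stability I (GM_star I) \<le> ereal (real n + 2) / ereal (real n - 2))"
proof -
  interpret facility_game I by unfold_locales (rule assms(1))
  define r where "r = (if k = 0 then 0 else if k = 1 then 1 else real k / (real k - 1))"
  have r: "0 \<le> r" "r \<le> 2"
    by (auto simp: r_def field_simps)
  have kn: "k \<le> n"
    using card_mono[OF finite_clients strategic_subset] assms by simp
  \<comment> \<open>For \<open>k > 1\<close> this is
    \<open>r \<le> 2 \<le> k \<le> n\<close>.\<close>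
  have rn: "r \<le> real n"
  proof (cases "k \<le> 1")
    case True
    then show ?thesis using kn by (auto simp: r_def)
  next
    case False
    then show ?thesis using r kn by linarith
  qed
  obtain A B where AB: "A \<in> equilibrium_facilities I (GM_star I)" "B \<in> F"
      "true_cost I B \<le> true_cost I (optimal_facility I)"
    and cost: "true_cost I A \<le> true_cost I B + r * d B A"
  proof -
    consider "k = 0" | "k = 1" | "1 < k" by linarith
    then show thesis
    proof cases
      case 1
      then have "L = {}" using assms(3) by simp
      then show thesis
        using that[OF truthful_outcome_equilibrium_if_no_strategic _ truthful_outcome_optimal] 1
        by (simp add: r_def)
    next
      case 2
      then show thesis
        using good_equilibrium_one_strategic that assms(3) by (auto simp: r_def)
    next
      case 3
      obtain A where "A \<in> equilibrium_facilities I (GM_star I)"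
        "true_cost I A \<le> true_cost I (optimal_facility I)
           + real k / (real k - 1) * d (optimal_facility I) A"
        using good_equilibrium_many_strategic[OF assms(3) 3 optimal_facility] .
      then show thesis
        using that[OF _ optimal_facility order_refl] 3 by (simp add: r_def)
    qed
  qed
  \<comment> \<open>Enlarging \<open>r\<close> keeps the cost bound valid; \<open>s = 2\<close>
    yields the claim for arbitrary \<open>k\<close>.\<close>
  have bound: "price_of_stability I (GM_star I) \<le> ereal (real n + s) / ereal (real n - s)"
    if "r \<le> s" "s \<le> real n" "0 < n" for s
  proof (rule price_of_stability_le[OF AB])
    show "true_cost I A \<le> true_cost I B + s * d B A"
      using cost mult_right_mono[OF \<open>r \<le> s\<close>, of "d B A"] by simp
  qed (use that r assms(2) in auto)
  show ?thesis
    using bound[of r] bound[of 2] r rn kn by (auto simp: r_def split: if_splits)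
qed

end
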